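(* Let $k\ge 2$, suppose $n\ge 2k^2$, and let $V$ be a set with $|V|=2n$. Then there is a sequence of colorings $\chi_0,\dots,\chi_\ell\colon V^k\to C$ of length $\ell\ge(\frac{n}{2k})^{k-1}$ such that (I) $\chi_t$ is shufflable and compatible with equality for all $t\in\{0,\dots,\ell\}$, (II) $\chi_t$ is $k$-stable for all $t\in\{0,\dots,\ell\}$, and (III) $\chi_t\prec\chi_{t-1}$ for all $t\in\{1,\dots,\ell\}$.
   Context: For colorings $\chi_1,\chi_2\colon V^k\to C$: $\chi_1\preceq\chi_2$ if $\chi_1(\vec v)=\chi_1(\vec w)$ implies $\chi_2(\vec v)=\chi_2(\vec w)$; $\chi_1\equiv\chi_2$ if both directions hold; $\chi_1\prec\chi_2$ if $\chi_1\preceq\chi_2$ and $\chi_1\not\equiv\chi_2$. The $k$-WL refinement is $\chi'(\vec v)=\big(\chi(\vec v),\{\!\{(\chi(\vec v[w/1]),\dots,\chi(\vec v[w/k]))\mid w\in V\}\!\}\big)$ with $\vec v[w/i]$ the tuple with $i$-th entry replaced by $w$; $\chi$ is $k$-stable if $\chi'\equiv\chi$. A coloring is compatible with equality if tuples $(v_i)$, $(w_i)$ of equal color satisfy $v_i=v_j\iff w_i=w_j$ for all $i,j$. It is shufflable if for every function $\pi\colon[k]\to[k]$, equal color of $(v_1,\dots,v_k)$ and $(w_1,\dots,w_k)$ implies equal color of $(v_{\pi(1)},\dots,v_{\pi(k)})$ and $(w_{\pi(1)},\dots,w_{\pi(k)})$. *)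

theory Defs
  imports Complex_Main "HOL-Library.Multiset" "HOL-Library.NList"
begin

text \<open>
  A tuple in \<open>V\<^sup>k\<close> is a list in \<^term>\<open>nlists k V\<close>, with positions \<open>0, \<dots>, k - 1\<close>; the tuple
  \<open>v[w/i]\<close> is the list update \<^term>\<open>v[i := w]\<close>. Colorings are total functions on lists of which
  only the values on \<^term>\<open>nlists k V\<close> matter. The two colorings compared below may use different
  colors, as the refinement of a coloring does.
\<close>

definition coloring_le ::
    "nat \<Rightarrow> 'a set \<Rightarrow> ('a list \<Rightarrow> 'c) \<Rightarrow> ('a list \<Rightarrow> 'd) \<Rightarrow> bool" where
  "coloring_le k V \<chi>\<^sub>1 \<chi>\<^sub>2 \<longleftrightarrow>
     (\<forall>v \<in> nlists k V. \<forall>w \<in> nlists k V. \<chi>\<^sub>1 v = \<chi>\<^sub>1 w \<longrightarrow> \<chi>\<^sub>2 v = \<chi>\<^sub>2 w)"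

definition coloring_equiv ::
    "nat \<Rightarrow> 'a set \<Rightarrow> ('a list \<Rightarrow> 'c) \<Rightarrow> ('a list \<Rightarrow> 'd) \<Rightarrow> bool" where
  "coloring_equiv k V \<chi>\<^sub>1 \<chi>\<^sub>2 \<longleftrightarrow> coloring_le k V \<chi>\<^sub>1 \<chi>\<^sub>2 \<and> coloring_le k V \<chi>\<^sub>2 \<chi>\<^sub>1"

definition coloring_less ::
    "nat \<Rightarrow> 'a set \<Rightarrow> ('a list \<Rightarrow> 'c) \<Rightarrow> ('a list \<Rightarrow> 'd) \<Rightarrow> bool" where
  "coloring_less k V \<chi>\<^sub>1 \<chi>\<^sub>2 \<longleftrightarrow> coloring_le k V \<chi>\<^sub>1 \<chi>\<^sub>2 \<and> \<not> coloring_equiv k V \<chi>\<^sub>1 \<chi>\<^sub>2"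

text \<open>The multiset ranges over \<open>w \<in> V\<close>; this is meaningful for finite \<open>V\<close> only.\<close>

definition wl_refine ::
    "nat \<Rightarrow> 'a set \<Rightarrow> ('a list \<Rightarrow> 'c) \<Rightarrow> 'a list \<Rightarrow> 'c \<times> 'c list multiset" where
  "wl_refine k V \<chi> v =
     (\<chi> v, image_mset (\<lambda>w. map (\<lambda>i. \<chi> (v[i := w])) [0..<k]) (mset_set V))"

definition wl_stable :: "nat \<Rightarrow> 'a set \<Rightarrow> ('a list \<Rightarrow> 'c) \<Rightarrow> bool" where
  "wl_stable k V \<chi> \<longleftrightarrow> coloring_equiv k V (wl_refine k V \<chi>) \<chi>"

definition compatible_with_equality :: "nat \<Rightarrow> 'a set \<Rightarrow> ('a list \<Rightarrow> 'c) \<Rightarrow> bool" where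
  "compatible_with_equality k V \<chi> \<longleftrightarrow>
     (\<forall>v \<in> nlists k V. \<forall>w \<in> nlists k V. \<chi> v = \<chi> w \<longrightarrow>
        (\<forall>i<k. \<forall>j<k. v ! i = v ! j \<longleftrightarrow> w ! i = w ! j))"

definition shufflable :: "nat \<Rightarrow> 'a set \<Rightarrow> ('a list \<Rightarrow> 'c) \<Rightarrow> bool" where
  "shufflable k V \<chi> \<longleftrightarrow>
     (\<forall>\<pi> :: nat \<Rightarrow> nat. (\<forall>i<k. \<pi> i < k) \<longrightarrow>
        (\<forall>v \<in> nlists k V. \<forall>w \<in> nlists k V. \<chi> v = \<chi> w \<longrightarrow>
           \<chi> (map (\<lambda>i. v ! \<pi> i) [0..<k]) = \<chi> (map (\<lambda>i. w ! \<pi> i) [0..<k])))"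

end

theory Submission
  imports Defs "HOL-Library.FuncSet"
begin

text \<open>
  Split \<open>V\<close> into \<open>n\<close> pairs and fix a family \<open>E\<close> of \<open>k\<close>-sets of pairs. Call two tuples equivalent
  if one arises from the other by swapping the two points of some of the pairs, where inside every
  member of \<open>E\<close> covered by the tuple an even number of pairs is swapped. If distinct members of \<open>E\<close>
  never share \<open>k - 1\<close> pairs, then at most one member of \<open>E\<close> uses a given new pair and otherwise only
  pairs of the tuple, so each swap extends to the new pair: the equivalence is stable. Adding the
  members of \<open>E\<close> one by one refines it strictly each time. With \<open>m = n div k\<close>, the graphs of the
  functions \<open>g : [k] \<rightarrow> \<int>/m\<close> whose last value is the sum of the other ones form a
  family of \<open>m ^ (k - 1)\<close> such sets.
\<close>

text \<open>As simp rules these two loop once \<open>nlists_def\<close> unfolds their premises.\<close>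

declare nlistsE_length [simp del] nlistsE_set [simp del]

section \<open>Partial Steiner systems and parity conditions on their blocks\<close>

definition packing :: "nat \<Rightarrow> 'b set set \<Rightarrow> bool" where
  "packing k E \<longleftrightarrow> (\<forall>e\<in>E. finite e \<and> card e = k) \<and>
     (\<forall>e\<in>E. \<forall>e'\<in>E. k \<le> Suc (card (e \<inter> e')) \<longrightarrow> e = e')"

text \<open>Only the parities of \<open>z\<close> matter. Natural numbers serve as values so that
  composing swaps becomes pointwise addition.\<close>

definition balanced :: "'b set set \<Rightarrow> ('b \<Rightarrow> nat) \<Rightarrow> 'b set \<Rightarrow> bool" where
  "balanced E z P \<longleftrightarrow> (\<forall>e\<in>E. e \<subseteq> P \<longrightarrow> even (sum z e))"

lemma balanced_mono: "balanced E z P \<Longrightarrow> Q \<subseteq> P \<Longrightarrow> balanced E z Q"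
  by (auto simp: balanced_def)

lemma balanced_cong:
  assumes "\<And>x. x \<in> P \<Longrightarrow> z x = z' x"
  shows "balanced E z P \<longleftrightarrow> balanced E z' P"
proof -
  have "sum z e = sum z' e" if "e \<subseteq> P" for e
    using assms that by (intro sum.cong) auto
  then show ?thesis by (auto simp: balanced_def)
qed

text \<open>Two \<open>k\<close>-sets inside a set of at most \<open>k + 1\<close> points share at
  least \<open>k - 1\<close> of them by inclusion-exclusion, and a packing forbids this for distinct
  members.\<close>

lemma packing_unique_through_new_point:
  assumes "packing k E" "finite P" "card P \<le> k" "b \<notin> P"
    and e: "e \<in> E" "e \<subseteq> insert b P" "b \<in> e" and e': "e' \<in> E" "e' \<subseteq> insert b P" "b \<in> e'"
  shows "e = e'"
proof -
  have f: "finite e" "finite e'" "card e = k" "card e' = k"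
    using assms by (auto simp: packing_def)
  have "card (e \<union> e') \<le> card (insert b P)"
    using e e' assms(2) by (intro card_mono) auto
  then have "card (e \<union> e') \<le> Suc k"
    using assms by simp
  moreover have "card e + card e' = card (e \<union> e') + card (e \<inter> e')"
    using f by (intro card_Un_Int)
  ultimately have "k \<le> Suc (card (e \<inter> e'))"
    using f by linarith
  then show ?thesis
    using assms(1) e(1) e'(1) by (auto simp: packing_def)
qed

text \<open>A point \<open>b\<close> outside \<open>P\<close> lies in at most one member of
  \<open>E\<close> inside \<open>insert b P\<close>, so the parity at \<open>b\<close> faces at most
  one condition and can be chosen to meet it.\<close>

lemma balanced_extend:
  assumes "packing k E" "finite P" "card P \<le> k" "balanced E z P"
  obtains z' where "\<And>x. x \<in> P \<Longrightarrow> z' x = z x" "balanced E z' (insert b P)"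
proof (cases "\<exists>e\<in>E. e \<subseteq> insert b P \<and> b \<in> e \<and> b \<notin> P")
  case False
  then have "balanced E z (insert b P)"
    using assms(4) unfolding balanced_def by blast
  then show ?thesis using that by blast
next
  case True
  then obtain e where e: "e \<in> E" "e \<subseteq> insert b P" "b \<in> e" and b: "b \<notin> P" by blast
  have fin: "finite e" using e assms(1) by (auto simp: packing_def)
  \<comment> \<open>The value at \<open>b\<close> repeats the sum over the rest of \<open>e\<close>,
    so the sum over \<open>e\<close> is a double.\<close>
  define z' where "z' = z(b := sum z (e - {b}))"
  have agree: "z' x = z x" if "x \<in> P" for x using that b by (auto simp: z'_def)
  have "sum z' (e - {b}) = sum z (e - {b})"
    by (rule sum.cong) (auto simp: z'_def)
  then have "sum z' e = 2 * sum z (e - {b})"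
    using fin e(3) by (simp add: sum.remove[of e b] z'_def)
  then have even_e: "even (sum z' e)" by simp
  have "balanced E z' (insert b P)"
    unfolding balanced_def
  proof (intro ballI impI)
    fix e' assume e': "e' \<in> E" "e' \<subseteq> insert b P"
    show "even (sum z' e')"
    proof (cases "b \<in> e'")
      case True
      then show ?thesis
        using packing_unique_through_new_point[OF assms(1-3) b e e'] even_e by simp
    next
      case False
      then have "e' \<subseteq> P" using e' by auto
      moreover have "balanced E z' P" using assms(4) agree balanced_cong by blast
      ultimately show ?thesis using e' by (auto simp: balanced_def)
    qed
  qed
  then show ?thesis using that agree by blast
qed

text \<open>The color of an element is a numerical code of its class; codes exist because
  \<open>Pow A\<close> is finite.\<close>

lemma ex_nat_coloring_of_equivp_on:
  assumes "finite A"
    and refl: "\<And>x. x \<in> A \<Longrightarrow> R x x"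
    and sym: "\<And>x y. x \<in> A \<Longrightarrow> y \<in> A \<Longrightarrow> R x y \<Longrightarrow> R y x"
    and trans: "\<And>x y z. x \<in> A \<Longrightarrow> y \<in> A \<Longrightarrow> z \<in> A \<Longrightarrow> R x y \<Longrightarrow> R y z \<Longrightarrow> R x z"
  shows "\<exists>\<chi> :: 'x \<Rightarrow> nat. \<forall>x\<in>A. \<forall>y\<in>A. \<chi> x = \<chi> y \<longleftrightarrow> R x y"
proof -
  obtain g :: "'x set \<Rightarrow> nat" where g: "inj_on g (Pow A)"
    using finite_imp_inj_to_nat_seg[of "Pow A"] assms(1) by auto
  define c where "c x = {y\<in>A. R x y}" for x
  have "g (c x) = g (c y) \<longleftrightarrow> R x y" if "x \<in> A" "y \<in> A" for x y
  proof -
    have "g (c x) = g (c y) \<longleftrightarrow> c x = c y"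
      using g by (rule inj_on_eq_iff) (auto simp: c_def)
    also have "\<dots> \<longleftrightarrow> R x y"
      using that refl sym trans unfolding c_def by blast
    finally show ?thesis .
  qed
  then show ?thesis by (intro exI[of _ "\<lambda>x. g (c x)"]) auto
qed

section \<open>Swaps of paired points: \<open>p w\<close> names the pair of \<open>w\<close>, and
  \<open>s w\<close> is its partner\<close>

locale paired_points =
  fixes V :: "'a set" and p :: "'a \<Rightarrow> 'b" and s :: "'a \<Rightarrow> 'a"
  assumes finite_V: "finite V"
    and p_swap: "w \<in> V \<Longrightarrow> p (s w) = p w"
    and swap_in: "w \<in> V \<Longrightarrow> s w \<in> V"
    and swap_swap: "w \<in> V \<Longrightarrow> s (s w) = w"
    and swap_neq: "w \<in> V \<Longrightarrow> s w \<noteq> w"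
begin

definition twist :: "('b \<Rightarrow> nat) \<Rightarrow> 'a \<Rightarrow> 'a" where
  "twist z w = (if even (z (p w)) then w else s w)"

text \<open>Which \<open>z\<close> are admissible depends on the pairs met by the tuple. Twisting a
  tuple over \<open>V\<close> preserves those pairs, and this makes the relation an equivalence
  there.\<close>

definition twist_rel :: "'b set set \<Rightarrow> 'a list \<Rightarrow> 'a list \<Rightarrow> bool" where
  "twist_rel E v u \<longleftrightarrow> (\<exists>z. balanced E z (p ` set v) \<and> u = map (twist z) v)"

lemma p_twist: "w \<in> V \<Longrightarrow> p (twist z w) = p w"
  by (simp add: twist_def p_swap)

lemma twist_in: "w \<in> V \<Longrightarrow> twist z w \<in> V"
  by (simp add: twist_def swap_in)

lemma twist_twist: "w \<in> V \<Longrightarrow> twist z (twist z' w) = twist (\<lambda>x. z x + z' x) w"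
  by (auto simp: twist_def p_swap swap_swap)

lemma twist_self_inverse: "w \<in> V \<Longrightarrow> twist z (twist z w) = w"
  by (auto simp: twist_def p_swap swap_swap)

lemma twist_eq_iff: "w \<in> V \<Longrightarrow> w' \<in> V \<Longrightarrow> twist z w = twist z w' \<longleftrightarrow> w = w'"
  by (metis twist_self_inverse)

text \<open>Since \<open>s\<close> has no fixed point on \<open>V\<close>, the image of a point
  reveals whether its pair was swapped.\<close>

lemma twist_eqD: "w \<in> V \<Longrightarrow> twist z w = twist z' w \<Longrightarrow> even (z (p w)) \<longleftrightarrow> even (z' (p w))"
  using swap_neq[of w] by (auto simp: twist_def split: if_splits)

lemma p_set_map_twist: "set v \<subseteq> V \<Longrightarrow> p ` set (map (twist z) v) = p ` set v"
  by (force simp: p_twist image_image)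

lemma map_twist_in: "v \<in> nlists k V \<Longrightarrow> map (twist z) v \<in> nlists k V"
  by (auto simp: nlists_def twist_in)

lemma twist_rel_refl: "twist_rel E v v"
  unfolding twist_rel_def by (rule exI[of _ "\<lambda>_. 0"]) (auto simp: balanced_def twist_def map_idI)

lemma twist_rel_sym:
  assumes "set v \<subseteq> V" "twist_rel E v u"
  shows "twist_rel E u v"
proof -
  obtain z where z: "balanced E z (p ` set v)" "u = map (twist z) v"
    using assms by (auto simp: twist_rel_def)
  have "v = map (twist z) u"
    using assms(1) z(2) by (auto simp: twist_self_inverse intro!: map_idI[symmetric])
  moreover have "p ` set u = p ` set v"
    using p_set_map_twist assms(1) z(2) by blast
  ultimately show ?thesis unfolding twist_rel_def using z(1) by metis
qed

lemma twist_rel_trans: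
  assumes "set v \<subseteq> V" "twist_rel E v u" "twist_rel E u t"
  shows "twist_rel E v t"
proof -
  obtain z where z: "balanced E z (p ` set v)" "u = map (twist z) v"
    using assms by (auto simp: twist_rel_def)
  obtain z' where z': "balanced E z' (p ` set u)" "t = map (twist z') u"
    using assms by (auto simp: twist_rel_def)
  have "p ` set u = p ` set v"
    using p_set_map_twist assms(1) z(2) by blast
  then have "balanced E (\<lambda>x. z' x + z x) (p ` set v)"
    using z z' by (auto simp: balanced_def sum.distrib)
  moreover have "t = map (twist (\<lambda>x. z' x + z x)) v"
    using assms(1) z z' by (auto simp: twist_twist)
  ultimately show ?thesis unfolding twist_rel_def by blast
qed

section \<open>Colorings whose classes are the classes of \<open>twist_rel\<close>\<close>

definition represents :: "nat \<Rightarrow> 'b set set \<Rightarrow> ('a list \<Rightarrow> nat) \<Rightarrow> bool" where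
  "represents k E \<chi> \<longleftrightarrow> (\<forall>v\<in>nlists k V. \<forall>u\<in>nlists k V. \<chi> v = \<chi> u \<longleftrightarrow> twist_rel E v u)"

lemma representsD:
  "represents k E \<chi> \<Longrightarrow> v \<in> nlists k V \<Longrightarrow> u \<in> nlists k V \<Longrightarrow> \<chi> v = \<chi> u \<longleftrightarrow> twist_rel E v u"
  by (auto simp: represents_def)

lemma ex_represents: "\<exists>\<chi>. represents k E \<chi>"
  unfolding represents_def
proof (rule ex_nat_coloring_of_equivp_on)
  show "finite (nlists k V)"
    using finite_lists_length_eq[OF finite_V, of k] by (simp add: nlists_def conj_commute)
qed (use twist_rel_refl twist_rel_sym twist_rel_trans nlistsE_set in metis)+

text \<open>The same \<open>z\<close> works after reindexing: the new tuple has no new entries, so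
  it covers no new member of \<open>E\<close>.\<close>

lemma represents_shufflable:
  assumes \<chi>: "represents k E \<chi>"
  shows "shufflable k V \<chi>"
  unfolding shufflable_def
proof (intro allI impI ballI)
  fix \<pi> :: "nat \<Rightarrow> nat" and v u
  assume \<pi>: "\<forall>i<k. \<pi> i < k" and v: "v \<in> nlists k V" and u: "u \<in> nlists k V" and eq: "\<chi> v = \<chi> u"
  obtain z where z: "balanced E z (p ` set v)" "u = map (twist z) v"
    using representsD[OF \<chi> v u] eq by (auto simp: twist_rel_def)
  let ?v = "map (\<lambda>i. v ! \<pi> i) [0..<k]" and ?u = "map (\<lambda>i. u ! \<pi> i) [0..<k]"
  have len: "length v = k" using v by (simp add: nlists_def)
  have sub: "set ?v \<subseteq> set v" using \<pi> len by auto
  have in_v: "?v \<in> nlists k V" using sub v by (auto simp: nlists_def)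
  have u_eq: "?u = map (twist z) ?v" using z \<pi> len by auto
  have "balanced E z (p ` set ?v)" using z(1) sub by (blast intro: balanced_mono)
  then have "twist_rel E ?v ?u" using u_eq by (auto simp: twist_rel_def)
  then show "\<chi> ?v = \<chi> ?u"
    using representsD[OF \<chi> in_v] map_twist_in[OF in_v] u_eq by metis
qed

lemma represents_compatible:
  assumes \<chi>: "represents k E \<chi>"
  shows "compatible_with_equality k V \<chi>"
  unfolding compatible_with_equality_def
proof (intro allI impI ballI)
  fix v u i j
  assume v: "v \<in> nlists k V" and u: "u \<in> nlists k V" and eq: "\<chi> v = \<chi> u" and ij: "i < k" "j < k"
  obtain z where z: "u = map (twist z) v"
    using representsD[OF \<chi> v u] eq by (auto simp: twist_rel_def)
  have "length v = k" "v ! i \<in> V" "v ! j \<in> V" using v ij by (auto simp: nlists_def)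
  then show "v ! i = v ! j \<longleftrightarrow> u ! i = u ! j" using z ij by (simp add: twist_eq_iff)
qed

text \<open>For tuples of equal color, a bijection \<open>h\<close> of \<open>V\<close> is built
  such that replacing by \<open>w\<close> on one side and by \<open>h w\<close> on the other gives
  equal colors at all positions. The converse direction is immediate, as a refined color contains
  the old one.\<close>

lemma represents_wl_stable:
  assumes \<chi>: "represents k E \<chi>" and E: "packing k E"
  shows "wl_stable k V \<chi>"
proof -
  have "wl_refine k V \<chi> v = wl_refine k V \<chi> u"
    if v: "v \<in> nlists k V" and u: "u \<in> nlists k V" and eq: "\<chi> v = \<chi> u" for v u
  proof -
    obtain z where z: "balanced E z (p ` set v)" "u = map (twist z) v"
      using representsD[OF \<chi> v u] eq by (auto simp: twist_rel_def)
    have len: "length v = k" and sub: "set v \<subseteq> V" using v by (auto simp: nlists_def)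
    have card: "card (p ` set v) \<le> k"
      using card_image_le[of "set v" p] card_length[of v] len by simp
    have "\<exists>z'. (\<forall>x\<in>p ` set v. z' x = z x) \<and> balanced E z' (insert b (p ` set v))" for b
      using balanced_extend[OF E _ card z(1), of b] by (metis List.finite_set finite_imageI)
    \<comment> \<open>The extension depends on the pair \<open>b\<close>, not on the point: both
      points of a pair are twisted by the same function, which makes \<open>h\<close> an
      involution.\<close>
    then obtain Z where Z: "\<And>b x. x \<in> p ` set v \<Longrightarrow> Z b x = z x"
        "\<And>b. balanced E (Z b) (insert b (p ` set v))"
      by metis
    define h where "h w = twist (Z (p w)) w" for w
    have h_in: "h w \<in> V" if "w \<in> V" for w using that by (simp add: h_def twist_in)
    have h_h: "h (h w) = w" if "w \<in> V" for w
      using that by (simp add: h_def p_twist twist_self_inverse)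
    have bij: "bij_betw h V V"
      using h_in h_h by (intro bij_betw_byWitness[where f' = h]) auto
    have col: "\<chi> (u[i := h w]) = \<chi> (v[i := w])" if w: "w \<in> V" for w i
    proof -
      let ?z = "Z (p w)"
      have "u = map (twist ?z) v" using z Z(1) by (auto simp: twist_def)
      then have u': "u[i := h w] = map (twist ?z) (v[i := w])"
        by (simp add: map_update h_def)
      have sub': "set (v[i := w]) \<subseteq> insert w (set v)" by (rule set_update_subset_insert)
      have v': "v[i := w] \<in> nlists k V"
        using sub' sub w len by (auto simp: nlists_def)
      \<comment> \<open>The pairs of \<open>v[i := w]\<close> are among those of \<open>v\<close>
        and \<open>w\<close> for every \<open>i\<close>, so one choice of \<open>h w\<close> serves
        all positions.\<close>
      have "balanced E ?z (p ` set (v[i := w]))"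
        using sub' by (intro balanced_mono[OF Z(2)]) auto
      then have "twist_rel E (v[i := w]) (u[i := h w])" using u' by (auto simp: twist_rel_def)
      then show ?thesis using representsD[OF \<chi> v'] map_twist_in[OF v'] u' by metis
    qed
    have "image_mset (\<lambda>w. map (\<lambda>i. \<chi> (u[i := w])) [0..<k]) (mset_set V)
        = image_mset (\<lambda>w. map (\<lambda>i. \<chi> (u[i := w])) [0..<k]) (image_mset h (mset_set V))"
      using bij by (simp add: image_mset_mset_set bij_betw_def)
    also have "\<dots> = image_mset (\<lambda>w. map (\<lambda>i. \<chi> (v[i := w])) [0..<k]) (mset_set V)"
      using finite_V col by (auto simp: multiset.map_comp intro!: image_mset_cong)
    finally show ?thesis using eq by (simp add: wl_refine_def)
  qed
  moreover have "\<chi> v = \<chi> u" if "wl_refine k V \<chi> v = wl_refine k V \<chi> u" for v u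
    using that by (simp add: wl_refine_def)
  ultimately show ?thesis
    unfolding wl_stable_def coloring_equiv_def coloring_le_def by blast
qed

text \<open>Strictness is witnessed by a tuple \<open>v\<close> with one point from each pair in
  \<open>e\<close>: swapping a single one of these pairs violates only the condition for
  \<open>e\<close>.\<close>

lemma represents_insert_less:
  assumes \<chi>: "represents k E \<chi>" and \<chi>': "represents k (insert e E) \<chi>'"
    and E: "packing k (insert e E)" and e: "e \<notin> E" "e \<subseteq> p ` V" and k: "0 < k"
  shows "coloring_less k V \<chi>' \<chi>"
proof -
  have le: "coloring_le k V \<chi>' \<chi>"
    unfolding coloring_le_def
  proof (intro ballI impI)
    fix v u assume v: "v \<in> nlists k V" and u: "u \<in> nlists k V" and eq: "\<chi>' v = \<chi>' u"
    have "twist_rel (insert e E) v u" using representsD[OF \<chi>' v u] eq by simp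
    then have "twist_rel E v u" by (auto simp: twist_rel_def balanced_def)
    then show "\<chi> v = \<chi> u" using representsD[OF \<chi> v u] by simp
  qed
  have fin: "finite e" and card: "card e = k" using E by (auto simp: packing_def)
  obtain q where q: "\<And>x. x \<in> e \<Longrightarrow> q x \<in> V \<and> p (q x) = x"
    using e(2) that[of "inv_into V p"] by (auto simp: subset_iff inv_into_into f_inv_into_f)
  obtain xs where xs: "set xs = e" "distinct xs" using fin finite_distinct_list by blast
  obtain c where c: "c \<in> e" using card k by fastforce
  define z :: "'b \<Rightarrow> nat" where "z x = (if x = c then 1 else 0)" for x
  define v where "v = map q xs"
  define u where "u = map (twist z) v"
  have v: "v \<in> nlists k V"
    using xs q card distinct_card[of xs] by (auto simp: nlists_def v_def)
  have u: "u \<in> nlists k V" unfolding u_def by (rule map_twist_in[OF v])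
  have pv: "p ` set v = e" using q xs by (force simp: v_def image_image)
  \<comment> \<open>A member of \<open>E\<close> inside \<open>e\<close> has size \<open>k\<close>
    and so would be \<open>e\<close> itself, hence there is no condition to check.\<close>
  have "balanced E z e"
    unfolding balanced_def
  proof (intro ballI impI)
    fix e' assume e': "e' \<in> E" "e' \<subseteq> e"
    then have "card e' = card e" using E card by (auto simp: packing_def)
    then have "e' = e" using e' fin card_subset_eq by blast
    then show "even (sum z e')" using e' e(1) by simp
  qed
  then have same: "\<chi> v = \<chi> u"
    using representsD[OF \<chi> v u] pv by (auto simp: twist_rel_def u_def)
  have diff: "\<chi>' v \<noteq> \<chi>' u"
  proof
    assume "\<chi>' v = \<chi>' u"
    then obtain z' where z': "balanced (insert e E) z' e" "u = map (twist z') v"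
      using representsD[OF \<chi>' v u] pv by (auto simp: twist_rel_def)
    \<comment> \<open>The tuple \<open>u\<close> determines all parities on \<open>e\<close>, so no
      other choice of \<open>z'\<close> can repair the odd sum.\<close>
    have par: "even (z' x) \<longleftrightarrow> even (z x)" if x: "x \<in> e" for x
    proof -
      have "q x \<in> set v" using x xs by (simp add: v_def)
      then have "twist z' (q x) = twist z (q x)" using z'(2) by (auto simp: u_def)
      then show ?thesis using twist_eqD[of "q x" z' z] q[OF x] by simp
    qed
    have "even (sum z' e)" using z'(1) by (auto simp: balanced_def)
    moreover have "sum z' e = z' c + sum z' (e - {c})" using fin c by (rule sum.remove)
    moreover have "even (sum z' (e - {c}))"
      using par by (intro dvd_sum) (auto simp: z_def)
    moreover have "odd (z' c)" using par[OF c] by (simp add: z_def)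
    ultimately show False by simp
  qed
  show ?thesis
    using le same diff v u unfolding coloring_less_def coloring_equiv_def coloring_le_def by blast
qed

end

section \<open>A large packing from a check-digit code modulo \<open>m\<close>\<close>

lemma packing_subset: "packing k E \<Longrightarrow> F \<subseteq> E \<Longrightarrow> packing k F"
  unfolding packing_def by blast

lemma sum_cong_mod_one_coordinate:
  fixes f g :: "nat \<Rightarrow> nat"
  assumes "finite A" "j \<in> A" "\<And>i. i \<in> A - {j} \<Longrightarrow> f i = g i"
    and "sum f A mod m = sum g A mod m" "f j < m" "g j < m"
  shows "f j = g j"
proof -
  let ?c = "sum g (A - {j})"
  have "sum f A = f j + ?c" "sum g A = g j + ?c"
    using assms(1-3) by (auto simp: sum.remove[of A j] intro: sum.cong)
  then have "(f j + ?c) mod m = (g j + ?c) mod m" using assms(4) by simp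
  \<comment> \<open>Over the integers the common summand can be subtracted without
    truncation.\<close>
  then have "(int (f j) + int ?c) mod int m = (int (g j) + int ?c) mod int m"
    by (metis of_nat_add of_nat_mod)
  then have "int (f j) mod int m = int (g j) mod int m"
    by (metis add_diff_cancel_right' mod_diff_left_eq)
  then show ?thesis using assms(5,6) by simp
qed

text \<open>Words with a check digit differ in at least two positions if they differ at all, so
  their graphs share at most \<open>k - 2\<close> points. The first \<open>k - 1\<close> digits are
  free, which gives the count.\<close>

lemma ex_packing:
  fixes k m n :: nat
  assumes "0 < k" "0 < m" "k * m \<le> n"
  obtains E where "packing k E" "finite E" "card E = m ^ (k - 1)" "\<And>e. e \<in> E \<Longrightarrow> e \<subseteq> {..<n}"
proof -
  define F :: "(nat \<Rightarrow> nat) set" where "F = {..<k - 1} \<rightarrow>\<^sub>E {..<m}"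
  define ext where "ext f i = (if i = k - 1 then (\<Sum>j<k - 1. f j) mod m else f i)"
    for f :: "nat \<Rightarrow> nat" and i
  \<comment> \<open>The point with position \<open>i\<close> and value \<open>r\<close> is coded as
    \<open>m * i + r\<close>, which lies below \<open>k * m\<close>; division by \<open>m\<close>
    recovers the position.\<close>
  define edge where "edge f = (\<lambda>i. m * i + ext f i) ` {..<k}" for f
  have ext_less: "ext f i < m" if "f \<in> F" "i < k" for f i
    using that assms by (auto simp: ext_def F_def PiE_iff)
  have div: "(m * i + ext f i) div m = i" if "f \<in> F" "i < k" for f i
    using ext_less[OF that] assms by simp
  have inj: "inj_on (\<lambda>i. m * i + ext f i) {..<k}" if "f \<in> F" for f
    using div[OF that] by (auto intro!: inj_onI) (metis lessThan_iff)
  have fin_card: "finite (edge f) \<and> card (edge f) = k" if "f \<in> F" for f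
    using card_image[OF inj[OF that]] by (simp add: edge_def)
  have almost_disjoint: "f = g"
    if f: "f \<in> F" and g: "g \<in> F" and many: "k \<le> Suc (card (edge f \<inter> edge g))" for f g
  proof -
    \<comment> \<open>Common points of the two graphs come from positions of agreement, so at most
      one position lies outside \<open>I\<close>.\<close>
    define I where "I = {i. i < k \<and> ext f i = ext g i}"
    have "edge f \<inter> edge g \<subseteq> (\<lambda>i. m * i + ext f i) ` I"
    proof
      fix x assume "x \<in> edge f \<inter> edge g"
      then obtain i j where ij: "i < k" "x = m * i + ext f i" "j < k" "x = m * j + ext g j"
        by (auto simp: edge_def)
      then have "i = j" using div[OF f] div[OF g] by metis
      then have "i \<in> I" using ij by (simp add: I_def)
      then show "x \<in> (\<lambda>i. m * i + ext f i) ` I" using ij(2) by blast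
    qed
    moreover have "finite I" by (simp add: I_def)
    ultimately have "card (edge f \<inter> edge g) \<le> card I"
      by (metis card_image_le card_mono finite_imageI le_trans)
    moreover have "card ({..<k} - I) = k - card I"
      by (subst card_Diff_subset) (auto simp: I_def)
    ultimately have "card ({..<k} - I) \<le> 1" using many by simp
    then have uniq: "i = j" if "i < k" "j < k" "i \<notin> I" "j \<notin> I" for i j
      using that card_le_Suc0_iff_eq[of "{..<k} - I"] by auto
    have "f i = g i" if i: "i < k - 1" for i
    proof (rule ccontr)
      assume neq: "f i \<noteq> g i"
      then have "i \<notin> I" using i by (auto simp: I_def ext_def)
      then have rest: "j \<in> I" if "j < k" "j \<noteq> i" for j
        using uniq[of i j] that i \<open>i \<notin> I\<close> by (metis less_diff_conv add_lessD1)
      \<comment> \<open>If \<open>i\<close> is the only disagreement, the check digits agree, and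
        cancelling the other summands modulo \<open>m\<close> forces agreement at \<open>i\<close>
        too.\<close>
      have "k - 1 \<in> I" using rest[of "k - 1"] assms(1) i by auto
      then have "(\<Sum>j<k - 1. f j) mod m = (\<Sum>j<k - 1. g j) mod m"
        by (simp add: I_def ext_def)
      moreover have "f j = g j" if "j \<in> {..<k - 1} - {i}" for j
        using rest[of j] that by (auto simp: I_def ext_def)
      moreover have "f i < m" "g i < m" using f g i by (auto simp: F_def PiE_iff)
      ultimately have "f i = g i"
        using i by (intro sum_cong_mod_one_coordinate[of "{..<k - 1}" i f g m]) simp_all
      then show False using neq by simp
    qed
    then show "f = g" using f g unfolding F_def by (auto intro: PiE_ext)
  qed
  have fin_F: "finite F" unfolding F_def by (intro finite_PiE) auto
  have "inj_on edge F"
  proof (rule inj_onI)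
    fix f g assume "f \<in> F" "g \<in> F" "edge f = edge g"
    then show "f = g" using almost_disjoint[of f g] fin_card[of g] by simp
  qed
  then have "card (edge ` F) = m ^ (k - 1)"
    by (simp add: card_image F_def card_PiE)
  moreover have "packing k (edge ` F)"
    unfolding packing_def using fin_card almost_disjoint by blast
  moreover have "e \<subseteq> {..<n}" if e: "e \<in> edge ` F" for e
  proof
    fix x assume "x \<in> e"
    then obtain f i where fi: "f \<in> F" "i < k" "x = m * i + ext f i"
      using e by (auto simp: edge_def)
    have "x < m * Suc i" using ext_less[OF fi(1,2)] fi(3) by simp
    also have "\<dots> \<le> m * k" using fi(2) by (intro mult_le_mono) auto
    finally show "x \<in> {..<n}" using assms(3) by (simp add: mult.commute)
  qed
  ultimately show ?thesis using that fin_F by blast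
qed

section \<open>Pairing up a set of \<open>2 * n\<close> points\<close>

lemma ex_paired_points:
  assumes "finite V" "card V = 2 * n"
  obtains p :: "'a \<Rightarrow> nat" and s where "paired_points V p s" "p ` V = {..<n}"
proof -
  obtain h where h: "bij_betw h V {0..<2 * n}"
    using ex_bij_betw_finite_nat[OF assms(1)] assms(2) by auto
  \<comment> \<open>On numbers, \<open>2 * j\<close> and \<open>2 * j + 1\<close> are partners, and
    \<open>div 2\<close> gives the index of their pair.\<close>
  define swap :: "nat \<Rightarrow> nat" where "swap i = (if even i then Suc i else i - 1)" for i
  define s where "s w = inv_into V h (swap (h w))" for w
  have less: "h w < 2 * n" if "w \<in> V" for w using h that by (auto simp: bij_betw_def)
  have swap_less: "swap i < 2 * n" if "i < 2 * n" for i
    using that by (auto simp: swap_def elim!: evenE oddE)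
  have swap: "swap (swap i) = i" "swap i div 2 = i div 2" "swap i \<noteq> i" for i
    by (auto simp: swap_def elim!: evenE oddE)
  have hs: "h (s w) = swap (h w)" if "w \<in> V" for w
    unfolding s_def using h swap_less[OF less[OF that]] by (simp add: bij_betw_inv_into_right)
  have s_in: "s w \<in> V" if "w \<in> V" for w
    unfolding s_def using h swap_less[OF less[OF that]]
    by (metis atLeastLessThan_iff bij_betw_def inv_into_into zero_le)
  have "paired_points V (\<lambda>w. h w div 2) s"
  proof
    fix w assume w: "w \<in> V"
    show "h (s w) div 2 = h w div 2" using hs[OF w] swap by simp
    show "s (s w) = w"
      unfolding s_def[of "s w"] using w h hs[OF w] swap by (simp add: bij_betw_inv_into_left)
    show "s w \<noteq> w" using hs[OF w] swap(3) by metis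
  qed (use assms s_in in auto)
  moreover have "(\<lambda>w. h w div 2) ` V = {..<n}"
  proof -
    have "(\<lambda>w. h w div 2) ` V = (\<lambda>i. i div 2) ` {0..<2 * n}"
      using h by (metis (no_types, lifting) bij_betw_imp_surj_on image_cong image_image)
    also have "\<dots> = {..<n}"
    proof
      show "{..<n} \<subseteq> (\<lambda>i. i div 2) ` {0..<2 * n}"
        by (auto intro!: image_eqI[of _ _ "2 * _"])
    qed auto
    finally show ?thesis .
  qed
  ultimately show ?thesis using that by blast
qed

section \<open>The chain of colorings\<close>

theorem theorem4p1:
  fixes k n :: nat and V :: "'a set"
  assumes "k \<ge> 2" and "n \<ge> 2 * k ^ 2" and "finite V" and "card V = 2 * n"
  shows "\<exists>(l :: nat) (\<chi> :: nat \<Rightarrow> 'a list \<Rightarrow> nat).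
           real l \<ge> (real n / (2 * real k)) ^ (k - 1) \<and>
           (\<forall>t \<in> {0..l}. shufflable k V (\<chi> t) \<and> compatible_with_equality k V (\<chi> t)) \<and>
           (\<forall>t \<in> {0..l}. wl_stable k V (\<chi> t)) \<and>
           (\<forall>t \<in> {1..l}. coloring_less k V (\<chi> t) (\<chi> (t - 1)))"
proof -
  define m where "m = n div k"
  have "k \<le> k * k" by simp
  then have "2 * k \<le> n" using assms(2) unfolding power2_eq_square by linarith
  then have m: "2 \<le> m" using assms(1) by (simp add: m_def less_eq_div_iff_mult_less_eq)
  \<comment> \<open>Rounding \<open>n / k\<close> down to \<open>m\<close> loses less than a factor
    of two, since \<open>m\<close> is positive; this accounts for the \<open>2\<close> in the
    bound.\<close>
  have "n < k * Suc m"
    using assms(1) by (simp add: m_def dividend_less_times_div)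
  also have "\<dots> \<le> k * (2 * m)" using m by (intro mult_le_mono) auto
  finally have "real n \<le> real (k * (2 * m))" by (intro of_nat_mono) simp
  then have "real n / (2 * real k) \<le> real m"
    using assms(1) by (simp add: field_simps)
  then have bound: "(real n / (2 * real k)) ^ (k - 1) \<le> real (m ^ (k - 1))"
    by (simp add: power_mono)
  obtain E where E: "packing k E" "finite E" "card E = m ^ (k - 1)" "\<And>e. e \<in> E \<Longrightarrow> e \<subseteq> {..<n}"
    using ex_packing[of k m n] assms(1) m by (auto simp: m_def)
  obtain es where es: "set es = E" "distinct es" using E(2) finite_distinct_list by blast
  have len: "length es = m ^ (k - 1)" using es E(3) distinct_card by metis
  obtain p :: "'a \<Rightarrow> nat" and s where "paired_points V p s" and p: "p ` V = {..<n}"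
    using ex_paired_points[OF assms(3,4)] .
  interpret paired_points V p s by fact
  \<comment> \<open>The coloring with index \<open>t\<close> uses the first \<open>t\<close> members
    of \<open>E\<close> in an arbitrary order, so the last index is the size of
    \<open>E\<close>.\<close>
  have "\<forall>t. \<exists>\<chi>. represents k (set (take t es)) \<chi>"
    using ex_represents by blast
  then obtain \<chi> where \<chi>: "\<And>t. represents k (set (take t es)) (\<chi> t)"
    by metis
  have pack: "packing k (set (take t es))" for t
    using packing_subset[OF E(1)] es set_take_subset by metis
  have "coloring_less k V (\<chi> (Suc t)) (\<chi> t)" if t: "t < length es" for t
  proof (rule represents_insert_less[OF \<chi>])
    have ins: "set (take (Suc t) es) = insert (es ! t) (set (take t es))"
      using t by (simp add: take_Suc_conv_app_nth)
    show "represents k (insert (es ! t) (set (take t es))) (\<chi> (Suc t))"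
      and "packing k (insert (es ! t) (set (take t es)))"
      using \<chi>[of "Suc t"] pack[of "Suc t"] unfolding ins by simp_all
    show "es ! t \<notin> set (take t es)"
      using es(2) t by (auto simp: in_set_conv_nth nth_eq_iff_index_eq)
    show "es ! t \<subseteq> p ` V" using E(4) es(1) p t nth_mem by metis
    show "0 < k" using assms(1) by simp
  qed
  then have "coloring_less k V (\<chi> t) (\<chi> (t - 1))" if "t \<in> {1..length es}" for t
    using that by (cases t) auto
  moreover have "shufflable k V (\<chi> t)" "compatible_with_equality k V (\<chi> t)"
    "wl_stable k V (\<chi> t)" for t
    using represents_shufflable[OF \<chi>] represents_compatible[OF \<chi>]
      represents_wl_stable[OF \<chi> pack] by blast+
  ultimately show ?thesis
    using bound len by (intro exI[of _ "length es"] exI[of _ \<chi>]) auto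
qed

end
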